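(* Let $S$ be a non-trivial transcendental semigroup. Then $K(S)=I(S)$ if and only if $I(S)$ is $S$-completely invariant.
   Context: A transcendental semigroup $S=\langle f_1,f_2,\ldots\rangle$ is the semigroup, under functional composition, generated by a set $\{f_i : i\in\mathbb{N}\}$ of transcendental entire functions $f_i:\mathbb{C}\to\mathbb{C}$ (possibly finitely many); $f^n$ denotes the $n$-th iterate of $f$. $S$ is trivial if it is generated by a single function, $S=\langle f\rangle$; otherwise it is non-trivial. The escaping set of $S$ is $I(S)=\{z\in\mathbb{C}: f^n(z)\to\infty\text{ as }n\to\infty\text{ for all }f\in S\}$. A set $U\subset\mathbb{C}$ is completely invariant under $f$ if $f(U)\subset U$ and $f^{-1}(U)\subset U$; it is $S$-completely invariant if this holds for all $f\in S$. The completely invariant escaping set of $S$ is defined as $$K(S)=\bigcap_{i\in\mathbb{N}}\{E_i : E_i \text{ is completely invariant under each } f\in S \text{ and each } E_i \text{ contains points } z\in\mathbb{C} \text{ such that } f^n(z)\to\infty \text{ as } n\to\infty \text{ for every } f\in S\},$$ that is, $K(S)=\bigcap_{i\in\mathbb{N}}E_i$ where the $E_i$ are the sets just described.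
   Formalization: In K(S), each E_i is required to contain all points z with fⁿ(z)→∞ for every f∈S (not merely some), and all such sets E are intersected; if only some such points are required, the claim fails, e.g. for S=⟨exp², exp³⟩ (iterates). *)

theory Defs
  imports "HOL-Complex_Analysis.Complex_Analysis" "HOL-Computational_Algebra.Polynomial"
begin

definition transcendental_entire :: "(complex \<Rightarrow> complex) \<Rightarrow> bool" where
  "transcendental_entire f \<longleftrightarrow> f holomorphic_on UNIV \<and> \<not> (\<exists>p. \<forall>z. f z = poly p z)"

(* No identity is adjoined: the elements are the non-empty compositions of generators. *)
inductive_set semigroup_generated :: "(complex \<Rightarrow> complex) set \<Rightarrow> (complex \<Rightarrow> complex) set"
  for F :: "(complex \<Rightarrow> complex) set"
where
  generator: "f \<in> F \<Longrightarrow> f \<in> semigroup_generated F"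
| composition: "f \<in> semigroup_generated F \<Longrightarrow> g \<in> semigroup_generated F \<Longrightarrow>
    f \<circ> g \<in> semigroup_generated F"

(* A sequence F of generators may have repetitions, so finite (non-empty) generating sets
   are included. *)
definition transcendental_semigroup :: "(complex \<Rightarrow> complex) set \<Rightarrow> bool" where
  "transcendental_semigroup S \<longleftrightarrow>
     (\<exists>F :: nat \<Rightarrow> complex \<Rightarrow> complex.
        (\<forall>i. transcendental_entire (F i)) \<and> S = semigroup_generated (range F))"

definition trivial_semigroup :: "(complex \<Rightarrow> complex) set \<Rightarrow> bool" where
  "trivial_semigroup S \<longleftrightarrow> (\<exists>f. S = semigroup_generated {f})"

definition escaping_set :: "(complex \<Rightarrow> complex) set \<Rightarrow> complex set" where
  "escaping_set S = {z. \<forall>f\<in>S. filterlim (\<lambda>n. (f ^^ n) z) at_infinity sequentially}"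

definition completely_invariant :: "(complex \<Rightarrow> complex) \<Rightarrow> complex set \<Rightarrow> bool" where
  "completely_invariant f U \<longleftrightarrow> f ` U \<subseteq> U \<and> f -` U \<subseteq> U"

definition semigroup_completely_invariant ::
    "(complex \<Rightarrow> complex) set \<Rightarrow> complex set \<Rightarrow> bool" where
  "semigroup_completely_invariant S U \<longleftrightarrow> (\<forall>f\<in>S. completely_invariant f U)"

(* "E contains points z that escape under every f in S" is read as: E contains all such
   points.  If E only had to contain some of them, then for S generated by the second and
   third iterates of exp, every grand orbit of exp inside I(exp) would be an admissible E.
   There are uncountably many of these, pairwise disjoint, so the intersection would be
   empty, although I(S) = I(exp) is non-empty and S-completely invariant.
   The intersection is over all admissible sets, not over a selected sequence of them;
   the family is never empty, since it contains UNIV. *)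
definition completely_invariant_escaping_set ::
    "(complex \<Rightarrow> complex) set \<Rightarrow> complex set" where
  "completely_invariant_escaping_set S =
     \<Inter> {E. (\<forall>f\<in>S. completely_invariant f E) \<and>
          (\<forall>z. (\<forall>f\<in>S. filterlim (\<lambda>n. (f ^^ n) z) at_infinity sequentially) \<longrightarrow> z \<in> E)}"

end

theory Submission imports Defs begin

text \<open>
  The completely invariant escaping set \<open>K(S)\<close> is a closure: complete invariance passes to
  intersections, because images and preimages are monotone, so \<open>K(S)\<close> is the least
  \<open>S\<close>-completely invariant set containing \<open>I(S)\<close>. A set equals its closure precisely when it
  is itself closed, and this is the claim.
\<close>

lemma semigroup_completely_invariant_Inter:
  assumes "\<And>E. E \<in> \<E> \<Longrightarrow> semigroup_completely_invariant S E"
  shows "semigroup_completely_invariant S (\<Inter>\<E>)"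
  using assms unfolding semigroup_completely_invariant_def completely_invariant_def by blast

lemma completely_invariant_escaping_set_eq_Inter:
  "completely_invariant_escaping_set S =
     \<Inter> {E. semigroup_completely_invariant S E \<and> escaping_set S \<subseteq> E}"
  unfolding completely_invariant_escaping_set_def semigroup_completely_invariant_def
    escaping_set_def subset_eq mem_Collect_eq by (simp add: Ball_def)

theorem proposition3p3:
  fixes S :: "(complex \<Rightarrow> complex) set"
  assumes "transcendental_semigroup S"
    and "\<not> trivial_semigroup S"
  shows "completely_invariant_escaping_set S = escaping_set S \<longleftrightarrow>
         semigroup_completely_invariant S (escaping_set S)"
proof
  have "semigroup_completely_invariant S (completely_invariant_escaping_set S)"
    unfolding completely_invariant_escaping_set_eq_Inter
    by (rule semigroup_completely_invariant_Inter) simp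
  then show "semigroup_completely_invariant S (escaping_set S)"
    if "completely_invariant_escaping_set S = escaping_set S"
    using that by simp
next
  assume "semigroup_completely_invariant S (escaping_set S)"
  then show "completely_invariant_escaping_set S = escaping_set S"
    unfolding completely_invariant_escaping_set_eq_Inter by blast
qed

end
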